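(* Assume that $y = X\beta^*+\varepsilon$, where $\beta^*\succeq 0$ has support $S=\{j:\beta^*_j>0\}$ with $1\le |S| = s < n$, and $\varepsilon$ has i.i.d. zero-mean sub-Gaussian entries with parameter $\sigma$. Assume that $X$ has the self-regularizing property with constant $\tau>0$ and that $X$ satisfies the $(3/\tau^2,s)$-restricted eigenvalue condition with constant $\phi(3/\tau^2,s)>0$ (see context). Let $\widehat{\beta}$ be a minimizer of the non-negative least squares problem $\min_{\beta\succeq0}\frac1n\|y-X\beta\|_2^2$. Then for any $q\in[1,2]$ and any $M\ge0$ it holds that $$\|\widehat{\beta}-\beta^*\|_q^q \le \frac{2^{3q-2}}{\{\phi(3/\tau^2,s)\}^q}\left(1+\frac{3}{\tau^2}\right)^{2q} s\left((1+M)\,\sigma\sqrt{\frac{2\log p}{n}}\right)^q,$$ $$\frac1n\|X\widehat{\beta}-X\beta^*\|_2^2\le\frac{8(1+M)^2\sigma^2}{\phi(3/\tau^2,s)}\left(1+\frac{3}{\tau^2}\right)^2\frac{s\log p}{n},$$ with probability no less than $1-2p^{-M^2}$.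
   Context: $X \in \mathbb{R}^{n\times p}$ is a deterministic design matrix with columns $X_1,\dots,X_p$ normalized such that $\|X_j\|_2^2 = n$ for $j=1,\dots,p$, and $\Sigma=\frac1nX^\top X$. The symbol $\succeq$ denotes componentwise inequality, $\mathbf{1}$ is the vector of ones, and for a vector $\delta$ and index set $J$, $\delta_J$ is the subvector indexed by $J$ and $J^c$ is the complement of $J$ in $\{1,\dots,p\}$. A zero-mean random variable $Z$ is sub-Gaussian with parameter $\sigma>0$ if $\mathbf{E}[\exp(tZ)]\le\exp(\sigma^2t^2/2)$ for all $t\in\mathbb{R}$. Self-regularizing property: with $$\tau_0 = \max\left\{\tau : \exists w\in\mathbb{R}^n,\ \|w\|_2\le 1,\ \text{such that } \frac{X^\top w}{\sqrt{n}} \succeq \tau\mathbf{1}\right\},$$ $X$ has the self-regularizing property with constant $\tau>0$ if $\tau_0\ge\tau>0$. Restricted eigenvalue condition: let $\mathcal{J}(s)=\{J\subseteq\{1,\dots,p\}:1\le|J|\le s\}$ and, for $J\in\mathcal{J}(s)$ and $\alpha\ge1$, $\mathcal{R}(J,\alpha)=\{\delta\in\mathbb{R}^p:\|\delta_{J^c}\|_1\le\alpha\|\delta_J\|_1\}$. The design satisfies the $(\alpha,s)$-restricted eigenvalue condition if there exists a constant $\phi(\alpha,s)$ such that $$\min_{J\in\mathcal{J}(s)}\ \min_{\delta\in\mathcal{R}(J,\alpha)\setminus\{0\}}\frac{\delta^\top\Sigma\delta}{\|\delta_J\|_2^2}\ge\phi(\alpha,s)>0.$$ *)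

theory Defs
  imports "HOL-Probability.Probability"
begin

text \<open>The design matrix has type \<open>real ^ 'p ^ 'n\<close>: \<open>n = CARD('n)\<close> rows (observations) and
  \<open>p = CARD('p)\<close> columns (variables).  The relation \<open>\<le>\<close> on vectors is the componentwise order.\<close>

definition normalized_columns :: "real ^ 'p ^ 'n \<Rightarrow> bool" where
  "normalized_columns X \<longleftrightarrow> (\<forall>j. (norm (column j X))\<^sup>2 = real CARD('n))"

definition Gram :: "real ^ 'p ^ 'n \<Rightarrow> real ^ 'p ^ 'p" where
  "Gram X = (1 / real CARD('n)) *\<^sub>R (transpose X ** X)"

definition lq_norm :: "real \<Rightarrow> real ^ 'p \<Rightarrow> real" where
  "lq_norm q v = (\<Sum>j\<in>UNIV. \<bar>v $ j\<bar> powr q) powr (1 / q)"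

text \<open>The subvector of \<open>v\<close> indexed by \<open>J\<close>, padded with zeros outside \<open>J\<close>; the padding does not
  affect any of its norms.\<close>

definition subvec :: "real ^ 'p \<Rightarrow> 'p set \<Rightarrow> real ^ 'p" where
  "subvec v J = (\<chi> j. if j \<in> J then v $ j else 0)"

definition self_reg_feasible :: "real ^ 'p ^ 'n \<Rightarrow> real \<Rightarrow> bool" where
  "self_reg_feasible X \<tau> \<longleftrightarrow>
     (\<exists>w. norm w \<le> 1 \<and> \<tau> *\<^sub>R 1 \<le> (1 / sqrt (real CARD('n))) *\<^sub>R (transpose X *v w))"

definition tau0 :: "real ^ 'p ^ 'n \<Rightarrow> real" where
  "tau0 X = (GREATEST \<tau>. self_reg_feasible X \<tau>)"

text \<open>The maximum is attained, so \<open>GREATEST\<close> is meaningful here.\<close>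

lemma tau0_is_max:
  fixes X :: "real ^ 'p ^ 'n"
  shows "self_reg_feasible X (tau0 X)"
    and "self_reg_feasible X \<tau> \<Longrightarrow> \<tau> \<le> tau0 X"
proof -
  define L :: "real ^ 'n \<Rightarrow> real ^ 'p"
    where "L w = (1 / sqrt (real CARD('n))) *\<^sub>R (transpose X *v w)" for w
  have feas: "self_reg_feasible X t \<longleftrightarrow> (\<exists>w. norm w \<le> 1 \<and> (\<forall>j. t \<le> L w $ j))" for t
    by (simp add: self_reg_feasible_def L_def less_eq_vec_def)
  have lin: "bounded_linear L"
    unfolding L_def
    by (rule bounded_linear_compose[OF bounded_linear_scaleR_right matrix_vector_mul_bounded_linear])
  have cont: "continuous_on UNIV (\<lambda>z::(real ^ 'n) \<times> real. L (fst z) $ j)" for j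
    by (rule continuous_on_component[OF bounded_linear.continuous_on[OF lin continuous_on_fst[OF continuous_on_id]]])
  have bound: "t \<le> onorm L" if t: "self_reg_feasible X t" for t
  proof -
    obtain w where w: "norm w \<le> 1" "\<forall>j. t \<le> L w $ j" using t unfolding feas by blast
    have "t \<le> L w $ undefined" by (rule spec[OF w(2)])
    also have "\<dots> \<le> \<bar>L w $ undefined\<bar>" by (rule abs_ge_self)
    also have "\<dots> \<le> norm (L w)" by (rule component_le_norm_cart)
    also have "\<dots> \<le> onorm L * norm w" by (rule onorm[OF lin])
    also have "\<dots> \<le> onorm L * 1" by (rule mult_left_mono[OF w(1) onorm_pos_le[OF lin]])
    finally show ?thesis by simp
  qed
  define K where "K = (cball 0 1 \<times> {0..onorm L}) \<inter> {z. \<forall>j. snd z \<le> L (fst z) $ j}"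
  have "compact K"
    unfolding K_def
  proof (rule compact_Int_closed)
    show "compact (cball 0 1 \<times> {0..onorm L} :: ((real ^ 'n) \<times> real) set)"
      by (rule compact_Times[OF compact_cball compact_Icc])
    show "closed {z. \<forall>j. snd z \<le> L (fst z) $ j}"
      by (rule closed_Collect_all, rule closed_Collect_le[OF continuous_on_snd[OF continuous_on_id] cont])
  qed
  then have comp: "compact (snd ` K)"
    by (rule compact_continuous_image[OF continuous_on_snd[OF continuous_on_id]])
  have K: "t \<in> snd ` K \<longleftrightarrow> self_reg_feasible X t \<and> 0 \<le> t" for t
  proof
    assume "t \<in> snd ` K"
    then obtain z where z: "z \<in> K" "t = snd z" by blast
    then have "norm (fst z) \<le> 1 \<and> (\<forall>j. t \<le> L (fst z) $ j)" "0 \<le> t"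
      by (auto simp: K_def)
    then show "self_reg_feasible X t \<and> 0 \<le> t" unfolding feas by blast
  next
    assume t: "self_reg_feasible X t \<and> 0 \<le> t"
    then obtain w where w: "norm w \<le> 1" "\<forall>j. t \<le> L w $ j" unfolding feas by blast
    then have "(w, t) \<in> K" using t bound[of t] by (simp add: K_def)
    then show "t \<in> snd ` K" by force
  qed
  have L0: "L 0 = 0" by (simp add: L_def)
  have "self_reg_feasible X 0"
    unfolding feas by (rule exI[of _ 0]) (simp add: L0)
  then have "0 \<in> snd ` K" by (simp add: K)
  then obtain m where m: "m \<in> snd ` K" "\<And>t. t \<in> snd ` K \<Longrightarrow> t \<le> m"
    using compact_attains_sup[OF comp] by blast
  have mf: "self_reg_feasible X m" "0 \<le> m" using m(1) K by auto
  have mm: "t \<le> m" if "self_reg_feasible X t" for t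
    using m(2)[of t] that K[of t] mf(2) by linarith
  have "tau0 X = m"
    unfolding tau0_def by (rule Greatest_equality) (use mf mm in auto)
  then show "self_reg_feasible X (tau0 X)" "self_reg_feasible X \<tau> \<Longrightarrow> \<tau> \<le> tau0 X"
    using mf mm by auto
qed

definition self_regularizing :: "real ^ 'p ^ 'n \<Rightarrow> real \<Rightarrow> bool" where
  "self_regularizing X \<tau> \<longleftrightarrow> tau0 X \<ge> \<tau> \<and> \<tau> > 0"

definition index_sets :: "nat \<Rightarrow> 'p::finite set set" where
  "index_sets s = {J. 1 \<le> card J \<and> card J \<le> s}"

definition RE_cone :: "'p set \<Rightarrow> real \<Rightarrow> (real ^ 'p) set" where
  "RE_cone J \<alpha> = {\<delta>. lq_norm 1 (subvec \<delta> (- J)) \<le> \<alpha> * lq_norm 1 (subvec \<delta> J)}"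

text \<open>A lower bound on the minimum is stated as a lower bound on every value.  The denominator
  never vanishes: if \<open>\<delta> \<in> RE_cone J \<alpha>\<close> and \<open>subvec \<delta> J = 0\<close>, then \<open>\<delta> = 0\<close>.\<close>

definition restricted_eigenvalue ::
    "real ^ 'p ^ 'n \<Rightarrow> real \<Rightarrow> nat \<Rightarrow> real \<Rightarrow> bool" where
  "restricted_eigenvalue X \<alpha> s \<phi> \<longleftrightarrow>
     \<phi> > 0 \<and>
     (\<forall>J \<in> index_sets s. \<forall>\<delta> \<in> RE_cone J \<alpha> - {0}.
        (\<delta> \<bullet> (Gram X *v \<delta>)) / (norm (subvec \<delta> J))\<^sup>2 \<ge> \<phi>)"

text \<open>Integrability is required explicitly because the Bochner integral of a non-integrable
  function is \<open>0\<close>.\<close>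

definition sub_gaussian :: "'a measure \<Rightarrow> ('a \<Rightarrow> real) \<Rightarrow> real \<Rightarrow> bool" where
  "sub_gaussian P Z \<sigma> \<longleftrightarrow>
     \<sigma> > 0 \<and> integrable P Z \<and> (\<integral>\<omega>. Z \<omega> \<partial>P) = 0 \<and>
     (\<forall>t. integrable P (\<lambda>\<omega>. exp (t * Z \<omega>)) \<and>
          (\<integral>\<omega>. exp (t * Z \<omega>) \<partial>P) \<le> exp (\<sigma>\<^sup>2 * t\<^sup>2 / 2))"

definition nnls_minimizer :: "real ^ 'p ^ 'n \<Rightarrow> real ^ 'n \<Rightarrow> real ^ 'p \<Rightarrow> bool" where
  "nnls_minimizer X y b \<longleftrightarrow>
     is_arg_min (\<lambda>\<beta>. (1 / real CARD('n)) * (norm (y - X *v \<beta>))\<^sup>2) (\<lambda>\<beta>. 0 \<le> \<beta>) b"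

end

theory Submission
  imports Defs
begin

text \<open>Let \<open>d = \<beta>hat - \<beta>s\<close>.  When \<open>\<bar>X\<^sub>j \<bullet> \<epsilon>\<bar> \<le> n \<nu>\<close> for all \<open>j\<close>, comparing the objective at \<open>\<beta>hat\<close> and
  \<open>\<beta>s\<close> gives \<open>\<parallel>X d\<parallel>\<^sup>2 / n \<le> 2 \<nu> \<parallel>d\<parallel>\<^sub>1\<close>.  If \<open>d\<close> lies in the cone of the restricted eigenvalue
  condition at \<open>S\<close>, this bounds \<open>\<parallel>d\<parallel>\<^sub>1\<close>, and the condition applied to the \<open>s\<close> largest entries of \<open>d\<close>
  bounds \<open>\<parallel>d\<parallel>\<^sub>2\<close>.  Outside the cone the nonnegative part of \<open>d\<close> dominates, and since \<open>d\<close> can be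
  negative on \<open>S\<close> only, the self-regularizing property yields
  \<open>\<tau>\<^sup>2 \<parallel>d\<parallel>\<^sub>1\<^sup>2 \<lesssim> \<parallel>X d\<parallel>\<^sup>2 / n\<close>, hence \<open>\<parallel>d\<parallel>\<^sub>1 \<le> 2 (1 + 3 / \<tau>\<^sup>2) \<nu>\<close>; this is enough because
  \<open>\<phi> \<le> 1\<close>.  Interpolation covers the norms in between.  A Chernoff bound and the union bound
  control the noise, with failure probability at most \<open>2 p powr (1 - (1 + M)\<^sup>2) \<le> 2 p powr (- M\<^sup>2)\<close>.\<close>

section \<open>The restricted eigenvalue condition and error bounds inside its cone\<close>

lemma inner_matrix_vector_columns:
  fixes X :: "real ^ 'p ^ 'n"
  shows "w \<bullet> (X *v d) = (\<Sum>j\<in>UNIV. (column j X \<bullet> w) * d $ j)"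
  by (simp add: inner_vec_def column_def matrix_vector_mult_def sum_distrib_left sum_distrib_right
      mult_ac) (rule sum.swap)

lemma inner_Gram:
  fixes X :: "real ^ 'p ^ 'n"
  shows "d \<bullet> (Gram X *v d) = (norm (X *v d))\<^sup>2 / real CARD('n)"
proof -
  have "d \<bullet> (Gram X *v d) = (d \<bullet> (transpose X *v (X *v d))) / real CARD('n)"
    by (simp add: Gram_def scaleR_matrix_vector_assoc[symmetric] matrix_vector_mul_assoc)
  also have "d \<bullet> (transpose X *v (X *v d)) = (X *v d) \<bullet> (X *v d)"
    by (metis dot_lmul_matrix transpose_matrix_vector inner_commute)
  finally show ?thesis by (simp add: power2_norm_eq_inner)
qed

lemma lq_norm_1_subvec: "lq_norm 1 (subvec v J) = (\<Sum>j\<in>J. \<bar>v $ j\<bar>)"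
proof -
  have "lq_norm 1 (subvec v J) = (\<Sum>j\<in>UNIV. if j \<in> J then \<bar>v $ j\<bar> else 0)"
    by (auto simp: lq_norm_def subvec_def sum_nonneg intro!: sum.cong)
  then show ?thesis by (simp add: sum.If_cases)
qed

lemma norm_subvec_power2: "(norm (subvec v J))\<^sup>2 = (\<Sum>j\<in>J. (v $ j)\<^sup>2)"
proof -
  have "(norm (subvec v J))\<^sup>2 = (\<Sum>j\<in>UNIV. if j \<in> J then (v $ j)\<^sup>2 else 0)"
    unfolding power2_norm_eq_inner
    by (auto simp: inner_vec_def subvec_def power2_eq_square intro!: sum.cong)
  then show ?thesis by (simp add: sum.If_cases)
qed

text \<open>Clearing the denominator gives a form that needs no side condition
  \<open>d \<noteq> 0\<close>: if the entries on \<open>J\<close> all vanish, the left-hand side is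
  0; otherwise \<open>d\<close> is nonzero and the quotient is defined.\<close>

lemma restricted_eigenvalueD:
  fixes X :: "real ^ 'p ^ 'n"
  assumes RE: "restricted_eigenvalue X \<alpha> s \<phi>"
    and J: "1 \<le> card J" "card J \<le> s"
    and cone: "(\<Sum>j\<in>-J. \<bar>d $ j\<bar>) \<le> \<alpha> * (\<Sum>j\<in>J. \<bar>d $ j\<bar>)"
  shows "\<phi> * (\<Sum>j\<in>J. (d $ j)\<^sup>2) \<le> (norm (X *v d))\<^sup>2 / real CARD('n)"
proof (cases "(\<Sum>j\<in>J. (d $ j)\<^sup>2) = 0")
  case True
  then show ?thesis by simp
next
  case False
  then have pos: "(\<Sum>j\<in>J. (d $ j)\<^sup>2) > 0"
    by (simp add: sum_nonneg less_le)
  have "d \<noteq> 0" using False by auto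
  then have "d \<in> RE_cone J \<alpha> - {0}" "J \<in> index_sets s"
    using J cone by (simp_all add: RE_cone_def lq_norm_1_subvec index_sets_def)
  then have "\<phi> \<le> (d \<bullet> (Gram X *v d)) / (norm (subvec d J))\<^sup>2"
    using RE unfolding restricted_eigenvalue_def by blast
  then show ?thesis using pos by (simp add: inner_Gram norm_subvec_power2 field_simps)
qed

text \<open>A coordinate vector \<open>axis k 1\<close> has no mass outside \<open>{k}\<close>, so
  it lies in the cone, and its quotient is the squared norm of a column divided by \<open>n\<close>,
  which is 1. The bound permits a factor \<open>1 / \<phi>\<close> to be inserted into estimates
  obtained outside the cone.\<close>

lemma restricted_eigenvalue_le_1:
  fixes X :: "real ^ 'p ^ 'n"
  assumes "restricted_eigenvalue X \<alpha> s \<phi>" "normalized_columns X" "1 \<le> s" "0 \<le> \<alpha>"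
  shows "\<phi> \<le> 1"
proof -
  fix k :: 'p
  have "\<phi> * (\<Sum>j\<in>{k}. (axis k (1::real) $ j)\<^sup>2) \<le> (norm (X *v axis k 1))\<^sup>2 / real CARD('n)"
  proof (rule restricted_eigenvalueD[OF assms(1)])
    have "(\<Sum>j\<in>-{k}. \<bar>axis k (1::real) $ j\<bar>) = 0"
      by (rule sum.neutral) (simp add: axis_def)
    then show "(\<Sum>j\<in>-{k}. \<bar>axis k (1::real) $ j\<bar>) \<le> \<alpha> * (\<Sum>j\<in>{k}. \<bar>axis k (1::real) $ j\<bar>)"
      using assms(4) by simp
  qed (use assms in auto)
  then show ?thesis using assms(2) by (simp add: matrix_vector_mult_basis normalized_columns_def)
qed

text \<open>Among the finitely many sets of size \<open>s\<close>, take one that maximizes the sum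
  of \<open>f\<close>. Exchanging a member \<open>i\<close> for a non-member \<open>k\<close> keeps
  the size, so it cannot raise the sum, which forces \<open>f k \<le> f i\<close>.\<close>

lemma ex_largest_entries:
  fixes f :: "'p::finite \<Rightarrow> real"
  assumes "s \<le> CARD('p)"
  obtains J where "card J = s"
    and "\<And>i k. i \<in> J \<Longrightarrow> k \<notin> J \<Longrightarrow> f k \<le> f i"
    and "\<And>S. card S = s \<Longrightarrow> sum f S \<le> sum f J"
proof -
  let ?F = "{J::'p set. card J = s}"
  have "finite ?F" "?F \<noteq> {}"
    using obtain_subset_with_card_n[OF assms] by auto
  then have "Max (sum f ` ?F) \<in> sum f ` ?F" by (intro Max_in) auto
  then obtain J where J: "card J = s" "sum f J = Max (sum f ` ?F)" by auto
  have Jmax: "sum f S \<le> sum f J" if "card S = s" for S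
    unfolding J(2) using that \<open>finite ?F\<close> by (intro Max_ge) auto
  have "f k \<le> f i" if ik: "i \<in> J" "k \<notin> J" for i k
  proof -
    have "card (insert k (J - {i})) = s"
      using ik J(1) card_Suc_Diff1[of J i] by simp
    moreover have "sum f (insert k (J - {i})) = f k + sum f J - f i"
      using ik by (simp add: sum_diff1)
    ultimately show ?thesis using Jmax[of "insert k (J - {i})"] by simp
  qed
  with J(1) Jmax that show thesis by blast
qed

lemma sum_Compl_add:
  fixes f :: "'p::finite \<Rightarrow> real"
  shows "sum f UNIV = sum f J + sum f (- J)"
  by (metis Compl_eq_Diff_UNIV add.commute finite sum.subset_diff top_greatest)

text \<open>Every entry outside \<open>J\<close> is at most the average \<open>A / s\<close> of the
  entries on \<open>J\<close>. Hence the squares outside \<open>J\<close> sum to at most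
  \<open>A / s\<close> times the l1 mass there, which the cone bounds by
  \<open>\<alpha> * A\<close>; Cauchy-Schwarz turns \<open>A\<^sup>2 / s\<close> back into the sum
  of squares on \<open>J\<close>.\<close>

lemma largest_entries_l2_bound:
  fixes d :: "real ^ 'p"
  assumes card: "card J = s" "1 \<le> s"
    and top: "\<And>i k. i \<in> J \<Longrightarrow> k \<notin> J \<Longrightarrow> \<bar>d $ k\<bar> \<le> \<bar>d $ i\<bar>"
    and cone: "(\<Sum>j\<in>-J. \<bar>d $ j\<bar>) \<le> \<alpha> * (\<Sum>j\<in>J. \<bar>d $ j\<bar>)" and \<alpha>: "0 \<le> \<alpha>"
  shows "(\<Sum>j\<in>UNIV. (d $ j)\<^sup>2) \<le> (1 + \<alpha>) * (\<Sum>j\<in>J. (d $ j)\<^sup>2)"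
proof -
  define A where "A = (\<Sum>j\<in>J. \<bar>d $ j\<bar>)"
  have A0: "0 \<le> A" by (simp add: A_def sum_nonneg)
  have le: "\<bar>d $ k\<bar> \<le> A / real s" if "k \<in> - J" for k
  proof -
    have "real (card J) * \<bar>d $ k\<bar> \<le> A"
      unfolding A_def using top that by (intro sum_bounded_below) auto
    then show ?thesis using card by (simp add: field_simps)
  qed
  have "(\<Sum>j\<in>-J. (d $ j)\<^sup>2) \<le> (\<Sum>j\<in>-J. A / real s * \<bar>d $ j\<bar>)"
    by (intro sum_mono) (use le in \<open>metis abs_ge_zero mult_right_mono power2_abs power2_eq_square\<close>)
  also have "\<dots> = A / real s * (\<Sum>j\<in>-J. \<bar>d $ j\<bar>)" by (simp add: sum_distrib_left)
  also have "\<dots> \<le> A / real s * (\<alpha> * A)"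
    using cone A0 by (intro mult_left_mono) (auto simp: A_def)
  also have "\<dots> = \<alpha> * (A\<^sup>2 / real s)" by (simp add: power2_eq_square)
  also have "\<dots> \<le> \<alpha> * (\<Sum>j\<in>J. (d $ j)\<^sup>2)"
  proof (rule mult_left_mono[OF _ \<alpha>])
    have "A\<^sup>2 \<le> (\<Sum>j\<in>J. \<bar>d $ j\<bar>\<^sup>2) * real (card J)"
      unfolding A_def by (rule sum_squared_le_sum_of_squares)
    then show "A\<^sup>2 / real s \<le> (\<Sum>j\<in>J. (d $ j)\<^sup>2)" using card by (simp add: field_simps)
  qed
  finally show ?thesis
    using sum_Compl_add[of "\<lambda>j. (d $ j)\<^sup>2" J] by (simp add: algebra_simps)
qed

text \<open>With \<open>A\<close> the l1 mass on \<open>S\<close>, the eigenvalue condition bounds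
  \<open>\<phi> * A\<^sup>2\<close> by a multiple of the prediction error, and the basic inequality
  with the cone bounds that error linearly in \<open>A\<close>; cancelling \<open>A\<close> gives
  the l1 bound. In the l2 bound, two factors \<open>1 + \<alpha>\<close> come from the prediction
  error and the third from passing from the largest entries to all entries.\<close>

lemma cone_error_bounds:
  fixes X :: "real ^ 'p ^ 'n"
  assumes RE: "restricted_eigenvalue X \<alpha> s \<phi>"
    and S: "card S = s" "1 \<le> s" and "0 \<le> \<alpha>" and "0 \<le> \<nu>"
    and basic: "(norm (X *v d))\<^sup>2 / real CARD('n) \<le> 2 * \<nu> * (\<Sum>j\<in>UNIV. \<bar>d $ j\<bar>)"
    and cone: "(\<Sum>j\<in>-S. \<bar>d $ j\<bar>) \<le> \<alpha> * (\<Sum>j\<in>S. \<bar>d $ j\<bar>)"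
  shows "(\<Sum>j\<in>UNIV. \<bar>d $ j\<bar>) \<le> 2 * \<nu> * (1 + \<alpha>)\<^sup>2 * real s / \<phi>"
    and "(\<Sum>j\<in>UNIV. (d $ j)\<^sup>2) \<le> 4 * \<nu>\<^sup>2 * (1 + \<alpha>) ^ 3 * real s / \<phi>\<^sup>2"
proof -
  have \<phi>: "\<phi> > 0" using RE by (simp add: restricted_eigenvalue_def)
  define D where "D = (norm (X *v d))\<^sup>2 / real CARD('n)"
  define L where "L = (\<Sum>j\<in>UNIV. \<bar>d $ j\<bar>)"
  define A where "A = (\<Sum>j\<in>S. \<bar>d $ j\<bar>)"
  have A0: "0 \<le> A" by (simp add: A_def sum_nonneg)
  have LA: "L \<le> (1 + \<alpha>) * A"
    using cone sum_Compl_add[of "\<lambda>j. \<bar>d $ j\<bar>" S] by (simp add: L_def A_def algebra_simps)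
  have "A\<^sup>2 \<le> (\<Sum>j\<in>S. \<bar>d $ j\<bar>\<^sup>2) * real (card S)"
    unfolding A_def by (rule sum_squared_le_sum_of_squares)
  then have "\<phi> * A\<^sup>2 \<le> \<phi> * (\<Sum>j\<in>S. (d $ j)\<^sup>2) * real s"
    using \<phi> S by (simp add: mult.assoc)
  also have "\<dots> \<le> D * real s"
    unfolding D_def using restricted_eigenvalueD[OF RE _ _ cone] S by (intro mult_right_mono) auto
  also have "\<dots> \<le> 2 * \<nu> * L * real s"
    using basic by (intro mult_right_mono) (auto simp: D_def L_def)
  also have "\<dots> \<le> 2 * \<nu> * ((1 + \<alpha>) * A) * real s"
    using LA \<open>0 \<le> \<nu>\<close> by (intro mult_right_mono mult_left_mono) auto
  finally have "(\<phi> * A) * A \<le> (2 * \<nu> * (1 + \<alpha>) * real s) * A"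
    by (simp add: power2_eq_square mult_ac)
  \<comment> \<open>If \<open>A = 0\<close> there is nothing to cancel, but then the left-hand side
    is 0 and the right-hand side is nonnegative.\<close>
  then have "\<phi> * A \<le> 2 * \<nu> * (1 + \<alpha>) * real s"
    using A0 \<open>0 \<le> \<nu>\<close> \<open>0 \<le> \<alpha>\<close> by (cases "A = 0") (auto simp: mult_le_cancel_right)
  then have "A \<le> 2 * \<nu> * (1 + \<alpha>) * real s / \<phi>"
    using \<phi> by (simp add: field_simps)
  with LA have "L \<le> (1 + \<alpha>) * (2 * \<nu> * (1 + \<alpha>) * real s / \<phi>)"
    using \<open>0 \<le> \<alpha>\<close> by (smt (verit) mult_left_mono)
  then show L: "(\<Sum>j\<in>UNIV. \<bar>d $ j\<bar>) \<le> 2 * \<nu> * (1 + \<alpha>)\<^sup>2 * real s / \<phi>"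
    by (simp add: L_def power2_eq_square mult_ac)
  have "D \<le> 2 * \<nu> * (2 * \<nu> * (1 + \<alpha>)\<^sup>2 * real s / \<phi>)"
    using basic mult_left_mono[OF L, of "2 * \<nu>"] \<open>0 \<le> \<nu>\<close> by (simp add: D_def)
  then have D: "D \<le> 4 * \<nu>\<^sup>2 * (1 + \<alpha>)\<^sup>2 * real s / \<phi>"
    by (simp add: power2_eq_square mult_ac)
  have "s \<le> CARD('p)" using S(1) card_mono[of UNIV S] by simp
  then obtain J where J: "card J = s"
    "\<And>i k. i \<in> J \<Longrightarrow> k \<notin> J \<Longrightarrow> \<bar>d $ k\<bar> \<le> \<bar>d $ i\<bar>"
    "(\<Sum>j\<in>S. \<bar>d $ j\<bar>) \<le> (\<Sum>j\<in>J. \<bar>d $ j\<bar>)"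
    using ex_largest_entries[of s "\<lambda>j. \<bar>d $ j\<bar>"] S(1) by metis
  \<comment> \<open>Passing from \<open>S\<close> to \<open>J\<close> moves l1 mass into the set
    while the total stays the same, so the cone condition is inherited.\<close>
  have coneJ: "(\<Sum>j\<in>-J. \<bar>d $ j\<bar>) \<le> \<alpha> * (\<Sum>j\<in>J. \<bar>d $ j\<bar>)"
    using cone J(3) mult_left_mono[OF J(3) \<open>0 \<le> \<alpha>\<close>]
      sum_Compl_add[of "\<lambda>j. \<bar>d $ j\<bar>" S] sum_Compl_add[of "\<lambda>j. \<bar>d $ j\<bar>" J] by linarith
  have "\<phi> * (\<Sum>j\<in>J. (d $ j)\<^sup>2) \<le> D"
    unfolding D_def using restricted_eigenvalueD[OF RE _ _ coneJ] J(1) S by auto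
  then have "(\<Sum>j\<in>J. (d $ j)\<^sup>2) \<le> D / \<phi>" using \<phi> by (simp add: field_simps)
  also have "\<dots> \<le> (4 * \<nu>\<^sup>2 * (1 + \<alpha>)\<^sup>2 * real s / \<phi>) / \<phi>"
    using D \<phi> by (intro divide_right_mono) auto
  finally have "(1 + \<alpha>) * (\<Sum>j\<in>J. (d $ j)\<^sup>2)
      \<le> (1 + \<alpha>) * ((4 * \<nu>\<^sup>2 * (1 + \<alpha>)\<^sup>2 * real s / \<phi>) / \<phi>)"
    using \<open>0 \<le> \<alpha>\<close> by (intro mult_left_mono) auto
  also have "\<dots> = 4 * \<nu>\<^sup>2 * (1 + \<alpha>) ^ 3 * real s / \<phi>\<^sup>2"
    by (simp add: power2_eq_square power3_eq_cube mult_ac)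
  finally show "(\<Sum>j\<in>UNIV. (d $ j)\<^sup>2) \<le> 4 * \<nu>\<^sup>2 * (1 + \<alpha>) ^ 3 * real s / \<phi>\<^sup>2"
    using largest_entries_l2_bound[OF J(1) S(2) J(2) coneJ \<open>0 \<le> \<alpha>\<close>] by linarith
qed

section \<open>The self-regularizing property and error bounds outside the cone\<close>

text \<open>Let \<open>w\<close> attain \<open>tau0 X\<close>. The weights \<open>h j\<close>, the
  scaled inner products of \<open>w\<close> with the columns, lie between \<tau> and 1: the lower
  bound is self-regularization, the upper one Cauchy-Schwarz with columns of norm
  \<open>sqrt n\<close>. Pairing \<open>w\<close> with \<open>X *v d\<close> therefore weights
  nonnegative entries by at least \<tau> and negative ones by at most 1. The existence of such
  weights also shows \<tau> \<le> 1.\<close>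

lemma self_regularizing_lower_bound:
  fixes X :: "real ^ 'p ^ 'n"
  assumes norm: "normalized_columns X" and self: "self_regularizing X \<tau>"
  shows "\<tau> * (\<Sum>j | 0 \<le> d $ j. \<bar>d $ j\<bar>) - (\<Sum>j | d $ j < 0. \<bar>d $ j\<bar>)
      \<le> norm (X *v d) / sqrt (real CARD('n))"
    and "\<tau> \<le> 1"
proof -
  define r where "r = sqrt (real CARD('n))"
  have r: "r > 0" by (simp add: r_def)
  obtain w where w: "norm w \<le> 1" "\<And>j. tau0 X \<le> (transpose X *v w) $ j / r"
    using tau0_is_max(1)[of X] by (auto simp: self_reg_feasible_def less_eq_vec_def r_def)
  have tr: "(transpose X *v w) $ j = column j X \<bullet> w" for j
    by (simp add: matrix_vector_mul_component column_def transpose_def)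
  define h where "h j = (column j X \<bullet> w) / r" for j
  have h\<tau>: "\<tau> \<le> h j" for j
    using w(2)[of j] self unfolding tr by (simp add: h_def self_regularizing_def)
  have h1: "\<bar>h j\<bar> \<le> 1" for j
  proof -
    have "\<bar>column j X \<bullet> w\<bar> \<le> norm (column j X) * norm w" by (rule Cauchy_Schwarz_ineq2)
    also have "\<dots> \<le> norm (column j X) * 1" by (rule mult_left_mono[OF w(1)]) simp
    also have "norm (column j X) = r"
      using norm by (metis normalized_columns_def norm_ge_zero r_def real_sqrt_abs abs_of_nonneg)
    finally show ?thesis using r by (simp add: h_def field_simps)
  qed
  show "\<tau> \<le> 1" using h\<tau>[of undefined] h1[of undefined] by linarith
  have "\<tau> * (\<Sum>j | 0 \<le> d $ j. \<bar>d $ j\<bar>) - (\<Sum>j | d $ j < 0. \<bar>d $ j\<bar>)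
      = (\<Sum>j | 0 \<le> d $ j. \<tau> * \<bar>d $ j\<bar>) + (\<Sum>j | d $ j < 0. - \<bar>d $ j\<bar>)"
    by (simp add: sum_distrib_left sum_negf)
  also have "\<dots> \<le> (\<Sum>j | 0 \<le> d $ j. h j * d $ j) + (\<Sum>j | d $ j < 0. h j * d $ j)"
  proof (intro add_mono sum_mono)
    fix j assume "j \<in> {j. d $ j < 0}"
    then show "- \<bar>d $ j\<bar> \<le> h j * d $ j"
      using h1[of j] mult_right_mono_neg[of "h j" 1 "d $ j"] by simp
  qed (use h\<tau> in \<open>auto intro: mult_right_mono\<close>)
  also have "\<dots> = (\<Sum>j\<in>UNIV. h j * d $ j)"
    by (subst sum.union_disjoint[symmetric]) (auto intro!: sum.cong)
  also have "\<dots> = (w \<bullet> (X *v d)) / r"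
    by (simp add: inner_matrix_vector_columns h_def sum_divide_distrib)
  also have "\<dots> \<le> norm (X *v d) / r"
  proof (rule divide_right_mono)
    have "w \<bullet> (X *v d) \<le> norm w * norm (X *v d)" by (rule norm_cauchy_schwarz)
    also have "\<dots> \<le> 1 * norm (X *v d)" using w(1) by (rule mult_right_mono) simp
    finally show "w \<bullet> (X *v d) \<le> norm (X *v d)" by simp
  qed (use r in simp)
  finally show "\<tau> * (\<Sum>j | 0 \<le> d $ j. \<bar>d $ j\<bar>) - (\<Sum>j | d $ j < 0. \<bar>d $ j\<bar>)
      \<le> norm (X *v d) / sqrt (real CARD('n))" by (simp add: r_def)
qed

text \<open>Negative entries occur only on \<open>S\<close>, so failure of the cone condition passes
  to the sign split: the nonnegative mass \<open>a\<close> exceeds \<open>3 / \<tau>\<^sup>2\<close>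
  times the negative mass \<open>b\<close>. Self-regularization then bounds a multiple of
  \<open>a\<^sup>2\<close> by the prediction error, which the basic inequality bounds linearly in
  \<open>L\<close>, hence in \<open>a\<close>; cancelling \<open>a\<close> leaves a bound free of
  \<open>s\<close> and \<open>\<phi>\<close>.\<close>

lemma off_cone_l1_bound:
  fixes X :: "real ^ 'p ^ 'n"
  assumes norm: "normalized_columns X" and self: "self_regularizing X \<tau>" and "0 \<le> \<nu>"
    and off: "\<And>j. j \<notin> S \<Longrightarrow> 0 \<le> d $ j"
    and basic: "(norm (X *v d))\<^sup>2 / real CARD('n) \<le> 2 * \<nu> * (\<Sum>j\<in>UNIV. \<bar>d $ j\<bar>)"
    and ncone: "(\<Sum>j\<in>-S. \<bar>d $ j\<bar>) > 3 / \<tau>\<^sup>2 * (\<Sum>j\<in>S. \<bar>d $ j\<bar>)"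
  shows "(\<Sum>j\<in>UNIV. \<bar>d $ j\<bar>) \<le> 2 * (1 + 3 / \<tau>\<^sup>2) * \<nu>"
proof -
  have \<tau>: "0 < \<tau>" "\<tau> \<le> 1"
    using self self_regularizing_lower_bound(2)[OF norm self] by (auto simp: self_regularizing_def)
  define L where "L = (\<Sum>j\<in>UNIV. \<bar>d $ j\<bar>)"
  define a where "a = (\<Sum>j | 0 \<le> d $ j. \<bar>d $ j\<bar>)"
  define b where "b = (\<Sum>j | d $ j < 0. \<bar>d $ j\<bar>)"
  have "(- {j. 0 \<le> d $ j}) = {j. d $ j < 0}" by auto
  then have L: "L = a + b"
    using sum_Compl_add[of "\<lambda>j. \<bar>d $ j\<bar>" "{j. 0 \<le> d $ j}"] by (simp add: L_def a_def b_def)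
  have b0: "0 \<le> b" unfolding b_def by (rule sum_nonneg) simp
  have bS: "b \<le> (\<Sum>j\<in>S. \<bar>d $ j\<bar>)"
    unfolding b_def using off by (intro sum_mono2) (auto simp: not_less[symmetric])
  have aS: "(\<Sum>j\<in>-S. \<bar>d $ j\<bar>) \<le> a"
    unfolding a_def using off by (intro sum_mono2) auto
  have "3 / \<tau>\<^sup>2 * b \<le> 3 / \<tau>\<^sup>2 * (\<Sum>j\<in>S. \<bar>d $ j\<bar>)" using bS by (intro mult_left_mono) auto
  with ncone aS have "3 / \<tau>\<^sup>2 * b < a" by linarith
  then have b1: "3 * b \<le> \<tau>\<^sup>2 * a" using \<tau> by (simp add: field_simps)
  have "0 \<le> 3 / \<tau>\<^sup>2 * b" using b0 by simp
  with \<open>3 / \<tau>\<^sup>2 * b < a\<close> have a0: "0 < a" by linarith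
  have "\<tau>\<^sup>2 * a \<le> \<tau> * a" using \<tau> a0 by (intro mult_right_mono) (auto simp: power2_eq_square mult_left_le)
  \<comment> \<open>As \<tau> \<le> 1, \<open>b\<close> is at most a third of
    \<open>\<tau> * a\<close>, so two thirds of \<open>\<tau> * a\<close> survive the subtraction.
    This is what the 3 in the cone constant pays for.\<close>
  with b1 have "2 / 3 * \<tau> * a \<le> \<tau> * a - b" by simp
  also have "\<dots> \<le> norm (X *v d) / sqrt (real CARD('n))"
    unfolding a_def b_def by (rule self_regularizing_lower_bound(1)[OF norm self])
  finally have "(2 / 3 * \<tau> * a)\<^sup>2 \<le> (norm (X *v d) / sqrt (real CARD('n)))\<^sup>2"
    using \<tau> a0 by (intro power_mono) auto
  also have "\<dots> \<le> 2 * \<nu> * L" using basic by (simp add: power_divide L_def)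
  finally have "4 * \<tau>\<^sup>2 * a * a \<le> 18 * \<nu> * L" by (simp add: power2_eq_square mult_ac)
  \<comment> \<open>\<open>L\<close> is compared with \<open>a\<close> twice: here with the
    \<tau>-dependent factor that produces \<open>3 + \<tau>\<^sup>2\<close> in the result, and after
    the cancellation with the cruder factor \<open>4 / 3\<close>, which suffices to return from
    \<open>a\<close> to \<open>L\<close>.\<close>
  moreover have "3 * L \<le> (3 + \<tau>\<^sup>2) * a" using b1 L by (simp add: algebra_simps)
  then have "6 * \<nu> * (3 * L) \<le> 6 * \<nu> * ((3 + \<tau>\<^sup>2) * a)" using \<open>0 \<le> \<nu>\<close> by (intro mult_left_mono) auto
  ultimately have "(4 * \<tau>\<^sup>2 * a) * a \<le> (6 * \<nu> * (3 + \<tau>\<^sup>2)) * a" by (simp add: mult_ac)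
  then have "4 * \<tau>\<^sup>2 * a \<le> 6 * \<nu> * (3 + \<tau>\<^sup>2)" using a0 by (simp only: mult_le_cancel_right)
  moreover have "\<tau>\<^sup>2 * a \<le> a" using \<tau> a0 by (simp add: mult_le_cancel_right1 power_le_one)
  then have "3 * L \<le> 4 * a" using b1 L by linarith
  then have "\<tau>\<^sup>2 * (3 * L) \<le> \<tau>\<^sup>2 * (4 * a)" by (intro mult_left_mono) auto
  ultimately have "\<tau>\<^sup>2 * L \<le> 2 * \<nu> * (3 + \<tau>\<^sup>2)" by (simp only: distrib_left)
  then show ?thesis using \<tau> by (simp add: L_def field_simps)
qed

text \<open>Both cases are brought to one form. Inside the cone, \<open>4 * \<kappa> ^ 3\<close> is
  relaxed to \<open>16 * \<kappa> ^ 4\<close>; outside, the factor \<open>s / \<phi>\<close> is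
  inserted. The relaxed l2 constant is chosen so that interpolation with the l1 bound gives exactly
  the powers in the final estimate. The prediction bound is the basic inequality with the l1 bound
  substituted.\<close>

lemma nnls_error_bounds:
  fixes X :: "real ^ 'p ^ 'n"
  assumes norm: "normalized_columns X" and self: "self_regularizing X \<tau>"
    and RE: "restricted_eigenvalue X (3 / \<tau>\<^sup>2) s \<phi>"
    and S: "card S = s" "1 \<le> s" and "0 \<le> \<nu>"
    and off: "\<And>j. j \<notin> S \<Longrightarrow> 0 \<le> d $ j"
    and basic: "(norm (X *v d))\<^sup>2 / real CARD('n) \<le> 2 * \<nu> * (\<Sum>j\<in>UNIV. \<bar>d $ j\<bar>)"
  defines "\<kappa> \<equiv> 1 + 3 / \<tau>\<^sup>2"
  shows "(\<Sum>j\<in>UNIV. \<bar>d $ j\<bar>) \<le> 2 * \<nu> * \<kappa>\<^sup>2 * real s / \<phi>"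
    and "(\<Sum>j\<in>UNIV. (d $ j)\<^sup>2) \<le> 16 * \<nu>\<^sup>2 * \<kappa> ^ 4 * real s / \<phi>\<^sup>2"
    and "(norm (X *v d))\<^sup>2 / real CARD('n) \<le> 4 * \<nu>\<^sup>2 * \<kappa>\<^sup>2 * real s / \<phi>"
proof -
  have \<phi>: "0 < \<phi>" "\<phi> \<le> 1"
    using RE restricted_eigenvalue_le_1[OF RE norm S(2)] by (auto simp: restricted_eigenvalue_def)
  have \<kappa>: "1 \<le> \<kappa>" by (simp add: \<kappa>_def)
  have main: "(\<Sum>j\<in>UNIV. \<bar>d $ j\<bar>) \<le> 2 * \<nu> * \<kappa>\<^sup>2 * real s / \<phi> \<and>
      (\<Sum>j\<in>UNIV. (d $ j)\<^sup>2) \<le> 16 * \<nu>\<^sup>2 * \<kappa> ^ 4 * real s / \<phi>\<^sup>2"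
  proof (cases "(\<Sum>j\<in>-S. \<bar>d $ j\<bar>) \<le> 3 / \<tau>\<^sup>2 * (\<Sum>j\<in>S. \<bar>d $ j\<bar>)")
    case True
    have "(\<Sum>j\<in>UNIV. (d $ j)\<^sup>2) \<le> 4 * \<nu>\<^sup>2 * \<kappa> ^ 3 * real s / \<phi>\<^sup>2"
      unfolding \<kappa>_def by (rule cone_error_bounds[OF RE S _ \<open>0 \<le> \<nu>\<close> basic True]) simp
    also have "\<dots> \<le> 16 * \<nu>\<^sup>2 * \<kappa> ^ 4 * real s / \<phi>\<^sup>2"
    proof (intro divide_right_mono mult_right_mono mult_mono)
      show "\<kappa> ^ 3 \<le> \<kappa> ^ 4" by (rule power_increasing[OF _ \<kappa>]) simp
    qed (use \<kappa> in auto)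
    finally show ?thesis
      using cone_error_bounds(1)[OF RE S _ \<open>0 \<le> \<nu>\<close> basic True] by (simp add: \<kappa>_def)
  next
    case False
    then have L: "(\<Sum>j\<in>UNIV. \<bar>d $ j\<bar>) \<le> 2 * \<kappa> * \<nu>"
      using off_cone_l1_bound[OF norm self \<open>0 \<le> \<nu>\<close> off basic] by (simp add: \<kappa>_def)
    have "\<kappa> * 1 \<le> \<kappa> * \<kappa>" using \<kappa> by (intro mult_left_mono) auto
    then have "2 * \<kappa> * \<nu> \<le> 2 * \<nu> * \<kappa>\<^sup>2"
      using mult_left_mono[of \<kappa> "\<kappa>\<^sup>2" "2 * \<nu>"] \<open>0 \<le> \<nu>\<close> by (simp add: power2_eq_square mult_ac)
    \<comment> \<open>Multiplying by \<open>s / \<psi>\<close> cannot decrease a nonnegative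
      quantity because \<open>\<psi> \<le> 1 \<le> s\<close>; it is used with \<open>\<phi>\<close>
      for l1 and \<open>\<phi>\<^sup>2\<close> for l2.\<close>
    moreover have sp: "c \<le> c * real s / \<psi>" if "0 \<le> c" "0 < \<psi>" "\<psi> \<le> 1" for c \<psi> :: real
    proof -
      have "c * \<psi> \<le> c * real s" using S that by (intro mult_left_mono) auto
      then show ?thesis using that by (simp add: field_simps)
    qed
    ultimately have "(\<Sum>j\<in>UNIV. \<bar>d $ j\<bar>) \<le> 2 * \<nu> * \<kappa>\<^sup>2 * real s / \<phi>"
      using L sp[of "2 * \<nu> * \<kappa>\<^sup>2" \<phi>] \<phi> \<open>0 \<le> \<nu>\<close>
      by (meson order_trans mult_nonneg_nonneg zero_le_power2 zero_le_numeral)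
    moreover have "(\<Sum>j\<in>UNIV. (d $ j)\<^sup>2) \<le> 16 * \<nu>\<^sup>2 * \<kappa> ^ 4 * real s / \<phi>\<^sup>2"
    proof -
      have "(\<Sum>j\<in>UNIV. (d $ j)\<^sup>2) = (\<Sum>j\<in>UNIV. \<bar>d $ j\<bar> * \<bar>d $ j\<bar>)"
        by (simp add: power2_eq_square)
      \<comment> \<open>The l2 norm is at most the l1 norm: one factor of each square is replaced by
        the full l1 sum.\<close>
      also have "\<dots> \<le> (\<Sum>j\<in>UNIV. \<bar>d $ j\<bar> * (\<Sum>k\<in>UNIV. \<bar>d $ k\<bar>))"
        by (intro sum_mono mult_left_mono member_le_sum) auto
      also have "\<dots> = (\<Sum>j\<in>UNIV. \<bar>d $ j\<bar>)\<^sup>2"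
        by (simp add: power2_eq_square sum_distrib_right)
      also have "\<dots> \<le> (2 * \<kappa> * \<nu>)\<^sup>2" using L by (intro power_mono) (auto simp: sum_nonneg)
      also have "\<dots> = 4 * \<nu>\<^sup>2 * \<kappa>\<^sup>2" by (simp add: power_mult_distrib)
      also have "\<dots> \<le> 16 * \<nu>\<^sup>2 * \<kappa> ^ 4"
        using power_increasing[of 2 4 \<kappa>] \<kappa> by (intro mult_mono) auto
      also have "\<dots> \<le> 16 * \<nu>\<^sup>2 * \<kappa> ^ 4 * real s / \<phi>\<^sup>2"
        using \<phi> by (intro sp) (auto simp: power_le_one)
      finally show ?thesis .
    qed
    ultimately show ?thesis by simp
  qed
  then show "(\<Sum>j\<in>UNIV. \<bar>d $ j\<bar>) \<le> 2 * \<nu> * \<kappa>\<^sup>2 * real s / \<phi>"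
    and "(\<Sum>j\<in>UNIV. (d $ j)\<^sup>2) \<le> 16 * \<nu>\<^sup>2 * \<kappa> ^ 4 * real s / \<phi>\<^sup>2" by simp_all
  have "(norm (X *v d))\<^sup>2 / real CARD('n) \<le> 2 * \<nu> * (2 * \<nu> * \<kappa>\<^sup>2 * real s / \<phi>)"
    using main basic mult_left_mono[of "\<Sum>j\<in>UNIV. \<bar>d $ j\<bar>" "2 * \<nu> * \<kappa>\<^sup>2 * real s / \<phi>" "2 * \<nu>"]
      \<open>0 \<le> \<nu>\<close> by simp
  then show "(norm (X *v d))\<^sup>2 / real CARD('n) \<le> 4 * \<nu>\<^sup>2 * \<kappa>\<^sup>2 * real s / \<phi>"
    by (simp add: power2_eq_square mult_ac)
qed

section \<open>Interpolation between the l1 and l2 norms\<close>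

text \<open>The exponent splits as \<open>q = (2 - q) + 2 * (q - 1)\<close>, with weights
  \<open>2 - q\<close> and \<open>q - 1\<close> summing to 1. After scaling by \<open>B\<close> and
  \<open>C\<close>, weighted AM-GM is applied to each entry and the results are summed, which treats
  the endpoints 1 and 2 together with the interior.\<close>

lemma lq_norm_powr_interpolation:
  fixes v :: "real ^ 'p"
  assumes q: "1 \<le> q" "q \<le> 2"
    and l1: "(\<Sum>j\<in>UNIV. \<bar>v $ j\<bar>) \<le> B" and l2: "(\<Sum>j\<in>UNIV. (v $ j)\<^sup>2) \<le> C"
    and pos: "0 < B" "0 < C"
  shows "lq_norm q v powr q \<le> B powr (2 - q) * C powr (q - 1)"
proof -
  have term_le: "\<bar>v $ j\<bar> powr q
      \<le> B powr (2 - q) * C powr (q - 1) * ((2 - q) * (\<bar>v $ j\<bar> / B) + (q - 1) * ((v $ j)\<^sup>2 / C))" for j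
  proof (cases "v $ j = 0")
    case True
    then show ?thesis using q by simp
  next
    case False
    then have "(\<bar>v $ j\<bar> / B) powr (2 - q) * ((v $ j)\<^sup>2 / C) powr (q - 1)
        \<le> (2 - q) * (\<bar>v $ j\<bar> / B) + (q - 1) * ((v $ j)\<^sup>2 / C)"
      using q pos by (intro Youngs_inequality_0) auto
    then have "B powr (2 - q) * C powr (q - 1) *
        ((\<bar>v $ j\<bar> / B) powr (2 - q) * ((v $ j)\<^sup>2 / C) powr (q - 1)) \<le>
        B powr (2 - q) * C powr (q - 1) * ((2 - q) * (\<bar>v $ j\<bar> / B) + (q - 1) * ((v $ j)\<^sup>2 / C))"
      by (rule mult_left_mono) simp
    moreover have sq: "(v $ j)\<^sup>2 = \<bar>v $ j\<bar> powr 2" using False by simp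
    have "\<bar>v $ j\<bar> powr (2 - q) * (v $ j)\<^sup>2 powr (q - 1) = \<bar>v $ j\<bar> powr (2 - q + 2 * (q - 1))"
      unfolding sq powr_powr powr_add ..
    then have "\<bar>v $ j\<bar> powr (2 - q) * (v $ j)\<^sup>2 powr (q - 1) = \<bar>v $ j\<bar> powr q"
      by (simp add: algebra_simps)
    then have "B powr (2 - q) * C powr (q - 1) *
        ((\<bar>v $ j\<bar> / B) powr (2 - q) * ((v $ j)\<^sup>2 / C) powr (q - 1)) = \<bar>v $ j\<bar> powr q"
      using pos by (simp add: powr_divide)
    ultimately show ?thesis by simp
  qed
  have "lq_norm q v powr q = (\<Sum>j\<in>UNIV. \<bar>v $ j\<bar> powr q)"
    using q by (simp add: lq_norm_def powr_powr sum_nonneg)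
  also have "\<dots> \<le> (\<Sum>j\<in>UNIV. B powr (2 - q) * C powr (q - 1) *
      ((2 - q) * (\<bar>v $ j\<bar> / B) + (q - 1) * ((v $ j)\<^sup>2 / C)))"
    by (intro sum_mono term_le)
  also have "\<dots> = B powr (2 - q) * C powr (q - 1) *
      ((2 - q) * ((\<Sum>j\<in>UNIV. \<bar>v $ j\<bar>) / B) + (q - 1) * ((\<Sum>j\<in>UNIV. (v $ j)\<^sup>2) / C))"
    by (simp only: sum_distrib_left[symmetric] sum_divide_distrib[symmetric] sum.distrib)
  also have "\<dots> \<le> B powr (2 - q) * C powr (q - 1) * ((2 - q) * 1 + (q - 1) * 1)"
    using q l1 l2 pos by (intro mult_left_mono add_mono) (auto simp: divide_le_eq)
  finally show ?thesis by simp
qed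

section \<open>Optimality of the minimizer and concentration of the noise\<close>

text \<open>The true vector \<open>b0\<close> is feasible, so its objective value is no smaller than
  that of \<open>b\<close>. Expanding the squares cancels the noise energy and leaves the cross term
  \<open>2 * (e \<bullet> (X *v d))\<close>, which is bounded column by column.\<close>

lemma nnls_basic_inequality:
  fixes X :: "real ^ 'p ^ 'n"
  assumes min: "nnls_minimizer X (X *v b0 + e) b" and "0 \<le> b0"
    and noise: "\<And>j. \<bar>column j X \<bullet> e\<bar> \<le> real CARD('n) * \<nu>"
  shows "(norm (X *v (b - b0)))\<^sup>2 / real CARD('n) \<le> 2 * \<nu> * (\<Sum>j\<in>UNIV. \<bar>(b - b0) $ j\<bar>)"
proof -
  define d where "d = b - b0"
  have "(norm (X *v b0 + e - X *v b))\<^sup>2 \<le> (norm (X *v b0 + e - X *v b0))\<^sup>2"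
    using min \<open>0 \<le> b0\<close> by (auto simp: nnls_minimizer_def is_arg_min_linorder divide_le_cancel)
  also have "X *v b0 + e - X *v b = e - X *v d"
    by (simp add: d_def matrix_vector_mult_diff_distrib)
  finally have "(norm (X *v d))\<^sup>2 \<le> 2 * (e \<bullet> (X *v d))"
    by (simp add: power2_norm_eq_inner inner_diff_left inner_diff_right inner_commute)
  also have "e \<bullet> (X *v d) \<le> (\<Sum>j\<in>UNIV. real CARD('n) * \<nu> * \<bar>d $ j\<bar>)"
    unfolding inner_matrix_vector_columns
  proof (rule sum_mono)
    fix j
    have "(column j X \<bullet> e) * d $ j \<le> \<bar>column j X \<bullet> e\<bar> * \<bar>d $ j\<bar>" by (metis abs_ge_self abs_mult)
    also have "\<dots> \<le> real CARD('n) * \<nu> * \<bar>d $ j\<bar>" using noise by (rule mult_right_mono) simp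
    finally show "(column j X \<bullet> e) * d $ j \<le> real CARD('n) * \<nu> * \<bar>d $ j\<bar>" .
  qed
  finally have "(norm (X *v d))\<^sup>2 \<le> real CARD('n) * (2 * \<nu> * (\<Sum>j\<in>UNIV. \<bar>d $ j\<bar>))"
    by (simp add: sum_distrib_left[symmetric] mult_ac)
  then show ?thesis
    unfolding d_def[symmetric] by (simp add: divide_le_eq mult_ac)
qed

text \<open>Chernoff's method: independence factorizes the moment generating function of the
  weighted sum, so \<open>c \<bullet> \<epsilon>\<close> has a sub-Gaussian bound with parameter
  \<open>\<sigma> * norm c\<close>, and Markov's inequality is applied to the exponential.\<close>

lemma (in prob_space) sub_gaussian_inner_tail:
  fixes \<epsilon> :: "'a \<Rightarrow> real ^ 'n" and c :: "real ^ 'n"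
  assumes indep: "indep_vars (\<lambda>_. borel) (\<lambda>i \<omega>. \<epsilon> \<omega> $ i) UNIV"
    and sg: "\<And>i. sub_gaussian M (\<lambda>\<omega>. \<epsilon> \<omega> $ i) \<sigma>"
    and "c \<noteq> 0" and "0 \<le> u"
  shows "prob {\<omega> \<in> space M. u \<le> c \<bullet> \<epsilon> \<omega>} \<le> exp (- u\<^sup>2 / (2 * \<sigma>\<^sup>2 * (norm c)\<^sup>2))"
proof -
  have "\<sigma> > 0" using sg by (simp add: sub_gaussian_def)
  \<comment> \<open>This \<open>t\<close> minimizes the exponent
    \<open>\<sigma>\<^sup>2 * t\<^sup>2 * (norm c)\<^sup>2 / 2 - t * u\<close>.\<close>
  define t where "t = u / (\<sigma>\<^sup>2 * (norm c)\<^sup>2)"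
  have t0: "0 \<le> t" using \<open>0 \<le> u\<close> by (simp add: t_def)
  have ind: "indep_vars (\<lambda>_. borel) (\<lambda>i \<omega>. exp (t * c $ i * \<epsilon> \<omega> $ i)) UNIV"
    by (rule indep_vars_compose2[OF indep]) simp
  have int1: "integrable M (\<lambda>\<omega>. exp (t * c $ i * \<epsilon> \<omega> $ i))"
    and mgf1: "expectation (\<lambda>\<omega>. exp (t * c $ i * \<epsilon> \<omega> $ i)) \<le> exp (\<sigma>\<^sup>2 * (t * c $ i)\<^sup>2 / 2)" for i
    using sg[of i] by (simp_all add: sub_gaussian_def)
  have prod: "exp (t * (c \<bullet> \<epsilon> \<omega>)) = (\<Prod>i\<in>UNIV. exp (t * c $ i * \<epsilon> \<omega> $ i))" for \<omega>
    by (simp add: inner_vec_def sum_distrib_left exp_sum mult.assoc)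
  have int: "integrable M (\<lambda>\<omega>. exp (t * (c \<bullet> \<epsilon> \<omega>)))"
    unfolding prod by (rule indep_vars_integrable[OF _ ind int1]) simp
  have "expectation (\<lambda>\<omega>. exp (t * (c \<bullet> \<epsilon> \<omega>)))
      = (\<Prod>i\<in>UNIV. expectation (\<lambda>\<omega>. exp (t * c $ i * \<epsilon> \<omega> $ i)))"
    unfolding prod by (rule indep_vars_lebesgue_integral[OF _ ind int1]) simp
  also have "\<dots> \<le> (\<Prod>i\<in>UNIV. exp (\<sigma>\<^sup>2 * (t * c $ i)\<^sup>2 / 2))"
    by (intro prod_mono conjI mgf1 integral_nonneg_AE) auto
  also have "\<dots> = exp (\<sigma>\<^sup>2 * t\<^sup>2 * (norm c)\<^sup>2 / 2)"
    unfolding power2_norm_eq_inner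
    by (simp add: exp_sum[symmetric] inner_vec_def sum_distrib_left sum_divide_distrib power2_eq_square mult_ac)
  finally have mgf: "expectation (\<lambda>\<omega>. exp (t * (c \<bullet> \<epsilon> \<omega>))) \<le> exp (\<sigma>\<^sup>2 * t\<^sup>2 * (norm c)\<^sup>2 / 2)" .
  have "prob {\<omega> \<in> space M. u \<le> c \<bullet> \<epsilon> \<omega>} \<le> prob {\<omega> \<in> space M. exp (t * u) \<le> exp (t * (c \<bullet> \<epsilon> \<omega>))}"
  proof (rule finite_measure_mono)
    show "{\<omega> \<in> space M. exp (t * u) \<le> exp (t * (c \<bullet> \<epsilon> \<omega>))} \<in> events"
      using borel_measurable_integrable[OF int] by measurable
  qed (use t0 in \<open>auto intro: mult_left_mono\<close>)
  also have "\<dots> \<le> expectation (\<lambda>\<omega>. exp (t * (c \<bullet> \<epsilon> \<omega>))) / exp (t * u)"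
    by (rule integral_Markov_inequality_measure[OF int, of "{}"]) auto
  also have "\<dots> \<le> exp (\<sigma>\<^sup>2 * t\<^sup>2 * (norm c)\<^sup>2 / 2) / exp (t * u)"
    by (intro divide_right_mono mgf) simp
  also have "\<dots> = exp (\<sigma>\<^sup>2 * t\<^sup>2 * (norm c)\<^sup>2 / 2 - t * u)" by (simp add: exp_diff)
  also have "\<sigma>\<^sup>2 * t\<^sup>2 * (norm c)\<^sup>2 / 2 - t * u = - u\<^sup>2 / (2 * \<sigma>\<^sup>2 * (norm c)\<^sup>2)"
    using \<open>\<sigma> > 0\<close> \<open>c \<noteq> 0\<close> by (simp add: t_def field_simps power2_eq_square)
  finally show ?thesis .
qed

text \<open>The level \<nu> is set so that, for a column of squared norm \<open>n\<close>, the tail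
  exponent equals \<open>(1 + m)\<^sup>2 * ln p\<close>. A union bound over the \<open>2 * p\<close>
  one-sided events costs one further power of \<open>p\<close>.\<close>

lemma (in prob_space) sub_gaussian_noise_bound:
  fixes X :: "real ^ 'p ^ 'n" and \<epsilon> :: "'a \<Rightarrow> real ^ 'n"
  assumes norm: "normalized_columns X"
    and indep: "indep_vars (\<lambda>_. borel) (\<lambda>i \<omega>. \<epsilon> \<omega> $ i) UNIV"
    and sg: "\<And>i. sub_gaussian M (\<lambda>\<omega>. \<epsilon> \<omega> $ i) \<sigma>" and "0 \<le> m"
  defines "\<nu> \<equiv> (1 + m) * \<sigma> * sqrt (2 * ln (real CARD('p)) / real CARD('n))"
  defines "A \<equiv> {\<omega> \<in> space M. \<forall>j. \<bar>column j X \<bullet> \<epsilon> \<omega>\<bar> \<le> real CARD('n) * \<nu>}"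
  shows "A \<in> events" and "1 - 2 * real CARD('p) powr (- (m\<^sup>2)) \<le> prob A"
proof -
  define n p where "n = real CARD('n)" and "p = real CARD('p)"
  have n: "n > 0" by (simp add: n_def)
  have p: "p \<ge> 1" by (simp add: p_def Suc_leI)
  have \<sigma>: "\<sigma> > 0" using sg by (simp add: sub_gaussian_def)
  have \<nu>: "0 \<le> \<nu>" using \<open>0 \<le> m\<close> \<sigma> p n by (simp add: \<nu>_def n_def p_def)
  have [measurable]: "(\<lambda>\<omega>. \<epsilon> \<omega> $ i) \<in> borel_measurable M" for i
    using sg[of i] by (auto simp: sub_gaussian_def)
  have [measurable]: "(\<lambda>\<omega>. c \<bullet> \<epsilon> \<omega>) \<in> borel_measurable M" for c
    by (simp add: inner_vec_def)
  show A: "A \<in> events" unfolding A_def by measurable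
  \<comment> \<open>One-sided events suffice: an absolute value is large exactly when the column or
    its negative has a large inner product with the noise, and both have the same norm.\<close>
  define E where "E c = {\<omega> \<in> space M. n * \<nu> \<le> c \<bullet> \<epsilon> \<omega>}" for c
  have E: "E c \<in> events" for c unfolding E_def by measurable
  have PE: "prob (E c) \<le> p powr (- (1 + m)\<^sup>2)" if c: "(norm c)\<^sup>2 = n" for c
  proof -
    have "c \<noteq> 0" using c n by auto
    then have "prob (E c) \<le> exp (- (n * \<nu>)\<^sup>2 / (2 * \<sigma>\<^sup>2 * (norm c)\<^sup>2))"
      unfolding E_def using \<nu> n by (intro sub_gaussian_inner_tail[OF indep sg]) auto
    also have "\<nu>\<^sup>2 = (1 + m)\<^sup>2 * \<sigma>\<^sup>2 * (2 * ln p / n)"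
      using p n by (simp add: \<nu>_def power_mult_distrib n_def[symmetric] p_def[symmetric])
    then have "- (n * \<nu>)\<^sup>2 / (2 * \<sigma>\<^sup>2 * (norm c)\<^sup>2) = - (1 + m)\<^sup>2 * ln p"
      using n \<sigma> by (simp add: c power_mult_distrib power2_eq_square[of n])
    finally show ?thesis using p by (simp add: powr_def)
  qed
  have "space M - A \<subseteq> (\<Union>j\<in>UNIV. E (column j X) \<union> E (- column j X))"
  proof
    fix \<omega> assume "\<omega> \<in> space M - A"
    then obtain j where "\<omega> \<in> space M" "n * \<nu> < \<bar>column j X \<bullet> \<epsilon> \<omega>\<bar>"
      by (auto simp: A_def n_def not_le)
    then have "\<omega> \<in> E (column j X) \<union> E (- column j X)" by (auto simp: E_def)
    then show "\<omega> \<in> (\<Union>j\<in>UNIV. E (column j X) \<union> E (- column j X))" by blast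
  qed
  then have "prob (space M - A) \<le> prob (\<Union>j\<in>UNIV. E (column j X) \<union> E (- column j X))"
    using E by (intro finite_measure_mono) auto
  also have "\<dots> \<le> (\<Sum>j\<in>(UNIV::'p set). prob (E (column j X) \<union> E (- column j X)))"
    using E by (intro finite_measure_subadditive_finite) auto
  also have "\<dots> \<le> (\<Sum>j\<in>(UNIV::'p set). 2 * p powr (- (1 + m)\<^sup>2))"
  proof (rule sum_mono)
    fix j
    have "(norm (column j X))\<^sup>2 = n" using norm by (simp add: normalized_columns_def n_def)
    then have "prob (E (column j X)) \<le> p powr (- (1 + m)\<^sup>2)"
      "prob (E (- column j X)) \<le> p powr (- (1 + m)\<^sup>2)" by (simp_all add: PE)
    then show "prob (E (column j X) \<union> E (- column j X)) \<le> 2 * p powr (- (1 + m)\<^sup>2)"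
      using measure_Un_le[OF E E, of "column j X" "- column j X"] by linarith
  qed
  also have "\<dots> = 2 * (p powr 1 * p powr (- (1 + m)\<^sup>2))" using p by (simp add: p_def)
  also have "\<dots> = 2 * p powr (1 - (1 + m)\<^sup>2)" using powr_add[of p 1 "- (1 + m)\<^sup>2"] by simp
  \<comment> \<open>\<open>1 - (1 + m)\<^sup>2 = - m\<^sup>2 - 2 * m\<close>, and
    \<open>p \<ge> 1\<close> makes the power monotone in the exponent.\<close>
  also have "\<dots> \<le> 2 * p powr (- (m\<^sup>2))"
    using p \<open>0 \<le> m\<close> by (intro mult_left_mono powr_mono) (auto simp: power2_eq_square algebra_simps)
  finally show "1 - 2 * real CARD('p) powr (- (m\<^sup>2)) \<le> prob A"
    using prob_compl[OF A] by (simp add: p_def)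
qed

section \<open>Exponents of the interpolated constant and the final probability statement\<close>

text \<open>In logarithms this is a linear identity. With \<open>16 = 2 ^ 4\<close>, the exponent of
  2 is \<open>(2 - q) + 4 * (q - 1) = 3 * q - 2\<close>; those of \<open>\<nu>\<close>,
  \<open>\<kappa>\<close>, \<open>r\<close> and \<open>1 / \<phi>\<close> come to \<open>q\<close>,
  \<open>2 * q\<close>, 1 and \<open>q\<close>.\<close>

lemma lq_constant_eq:
  fixes \<nu> \<kappa> \<phi> r q :: real
  assumes "0 < \<nu>" "0 < \<kappa>" "0 < \<phi>" "0 < r"
  shows "(2 * \<nu> * \<kappa>\<^sup>2 * r / \<phi>) powr (2 - q) * (16 * \<nu>\<^sup>2 * \<kappa> ^ 4 * r / \<phi>\<^sup>2) powr (q - 1)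
    = 2 powr (3 * q - 2) / \<phi> powr q * \<kappa> powr (2 * q) * r * \<nu> powr q" (is "?l = ?r")
proof -
  have B: "ln (2 * \<nu> * \<kappa>\<^sup>2 * r / \<phi>) = ln 2 + ln \<nu> + 2 * ln \<kappa> + ln r - ln \<phi>"
    using assms by (simp add: ln_mult ln_div ln_realpow)
  have "ln (16 :: real) = 4 * ln 2" using ln_realpow[of 2 4] by simp
  then have C: "ln (16 * \<nu>\<^sup>2 * \<kappa> ^ 4 * r / \<phi>\<^sup>2)
      = 4 * ln 2 + 2 * ln \<nu> + 4 * ln \<kappa> + ln r - 2 * ln \<phi>"
    using assms by (simp add: ln_mult ln_div ln_realpow)
  have "?l = exp ((2 - q) * ln (2 * \<nu> * \<kappa>\<^sup>2 * r / \<phi>) + (q - 1) * ln (16 * \<nu>\<^sup>2 * \<kappa> ^ 4 * r / \<phi>\<^sup>2))"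
    using assms by (simp add: powr_def exp_add)
  also have "\<dots> = exp ((3 * q - 2) * ln 2 - q * ln \<phi> + 2 * q * ln \<kappa> + ln r + q * ln \<nu>)"
    unfolding B C by (simp only: exp_inj_iff) algebra
  also have "\<dots> = ?r"
    using assms by (simp add: powr_def exp_add exp_diff)
  finally show ?thesis .
qed

theorem theorem2:
  fixes X :: "real ^ 'p ^ 'n"
    and \<beta>s :: "real ^ 'p"
    and P :: "'a measure"
    and \<epsilon> y :: "'a \<Rightarrow> real ^ 'n"
    and \<beta>hat :: "'a \<Rightarrow> real ^ 'p"
    and \<sigma> \<tau> \<phi> q M :: real
    and s :: nat
  assumes "normalized_columns X"
    and "prob_space P"
    and "\<And>\<omega>. \<omega> \<in> space P \<Longrightarrow> y \<omega> = X *v \<beta>s + \<epsilon> \<omega>"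
    and "0 \<le> \<beta>s"
    and "card {j. \<beta>s $ j > 0} = s" and "1 \<le> s" and "s < CARD('n)"
    and "prob_space.indep_vars P (\<lambda>_. borel) (\<lambda>i \<omega>. \<epsilon> \<omega> $ i) UNIV"
    and "\<And>i j. distr P borel (\<lambda>\<omega>. \<epsilon> \<omega> $ i) = distr P borel (\<lambda>\<omega>. \<epsilon> \<omega> $ j)"
    and "\<And>i. sub_gaussian P (\<lambda>\<omega>. \<epsilon> \<omega> $ i) \<sigma>"
    and "self_regularizing X \<tau>"
    and "restricted_eigenvalue X (3 / \<tau>\<^sup>2) s \<phi>"
    and "\<And>\<omega>. \<omega> \<in> space P \<Longrightarrow> nnls_minimizer X (y \<omega>) (\<beta>hat \<omega>)"
    and "1 \<le> q" and "q \<le> 2" and "0 \<le> M"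
  shows "\<exists>A \<in> sets P.
      measure P A \<ge> 1 - 2 * real CARD('p) powr (- (M\<^sup>2)) \<and>
      (\<forall>\<omega> \<in> A.
         lq_norm q (\<beta>hat \<omega> - \<beta>s) powr q
           \<le> 2 powr (3 * q - 2) / \<phi> powr q * (1 + 3 / \<tau>\<^sup>2) powr (2 * q) * real s
              * ((1 + M) * \<sigma> * sqrt (2 * ln (real CARD('p)) / real CARD('n))) powr q
       \<and> (1 / real CARD('n)) * (norm (X *v \<beta>hat \<omega> - X *v \<beta>s))\<^sup>2
           \<le> 8 * (1 + M)\<^sup>2 * \<sigma>\<^sup>2 / \<phi> * (1 + 3 / \<tau>\<^sup>2)\<^sup>2
              * (real s * ln (real CARD('p)) / real CARD('n)))"
proof -
  interpret prob_space P by fact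
  define \<nu> where "\<nu> = (1 + M) * \<sigma> * sqrt (2 * ln (real CARD('p)) / real CARD('n))"
  define \<kappa> where "\<kappa> = 1 + 3 / \<tau>\<^sup>2"
  \<comment> \<open>All randomness is confined to this event; on it the estimates are deterministic
    for each outcome.\<close>
  define A where "A = {\<omega> \<in> space P. \<forall>j. \<bar>column j X \<bullet> \<epsilon> \<omega>\<bar> \<le> real CARD('n) * \<nu>}"
  have \<sigma>: "0 < \<sigma>" using assms(10) by (simp add: sub_gaussian_def)
  have \<phi>: "0 < \<phi>" using assms(12) by (simp add: restricted_eigenvalue_def)
  have \<kappa>: "0 < \<kappa>" by (simp add: \<kappa>_def add_pos_nonneg)
  have p: "1 \<le> real CARD('p)" by (simp add: Suc_leI)
  have \<nu>: "0 \<le> \<nu>" using \<sigma> p \<open>0 \<le> M\<close> by (simp add: \<nu>_def)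
  have \<nu>2: "\<nu>\<^sup>2 = (1 + M)\<^sup>2 * \<sigma>\<^sup>2 * (2 * ln (real CARD('p)) / real CARD('n))"
    using p by (simp add: \<nu>_def power_mult_distrib)
  have A: "A \<in> sets P" "1 - 2 * real CARD('p) powr (- (M\<^sup>2)) \<le> measure P A"
    unfolding A_def \<nu>_def by (rule sub_gaussian_noise_bound[OF assms(1,8,10,16)])+
  have "lq_norm q (\<beta>hat \<omega> - \<beta>s) powr q
        \<le> 2 powr (3 * q - 2) / \<phi> powr q * \<kappa> powr (2 * q) * real s * \<nu> powr q
      \<and> (1 / real CARD('n)) * (norm (X *v \<beta>hat \<omega> - X *v \<beta>s))\<^sup>2
        \<le> 8 * (1 + M)\<^sup>2 * \<sigma>\<^sup>2 / \<phi> * \<kappa>\<^sup>2 * (real s * ln (real CARD('p)) / real CARD('n))"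
    if "\<omega> \<in> A" for \<omega>
  proof
    have \<omega>: "\<omega> \<in> space P" "\<And>j. \<bar>column j X \<bullet> \<epsilon> \<omega>\<bar> \<le> real CARD('n) * \<nu>"
      using that by (auto simp: A_def)
    define d where "d = \<beta>hat \<omega> - \<beta>s"
    define S where "S = {j. \<beta>s $ j > 0}"
    have min: "nnls_minimizer X (X *v \<beta>s + \<epsilon> \<omega>) (\<beta>hat \<omega>)"
      using assms(3,13)[OF \<omega>(1)] by simp
    have basic: "(norm (X *v d))\<^sup>2 / real CARD('n) \<le> 2 * \<nu> * (\<Sum>j\<in>UNIV. \<bar>d $ j\<bar>)"
      unfolding d_def by (rule nnls_basic_inequality[OF min assms(4) \<omega>(2)])
    have "0 \<le> \<beta>hat \<omega>" using min by (simp add: nnls_minimizer_def is_arg_min_def)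
    \<comment> \<open>Outside the support
      \<open>\<beta>s $ j \<le> 0 \<le> \<beta>hat \<omega> $ j\<close>: the sign constraint of the
      estimator enters here.\<close>
    then have off: "0 \<le> d $ j" if "j \<notin> S" for j
      using that by (auto simp: d_def S_def less_eq_vec_def not_less intro: order_trans)
    have S: "card S = s" unfolding S_def by fact
    note bounds = nnls_error_bounds[OF assms(1,11,12) S assms(6) \<nu> off basic, folded \<kappa>_def]
    show "(1 / real CARD('n)) * (norm (X *v \<beta>hat \<omega> - X *v \<beta>s))\<^sup>2
        \<le> 8 * (1 + M)\<^sup>2 * \<sigma>\<^sup>2 / \<phi> * \<kappa>\<^sup>2 * (real s * ln (real CARD('p)) / real CARD('n))"
      using bounds(3) unfolding \<nu>2 by (simp add: d_def matrix_vector_mult_diff_distrib mult_ac)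
    show "lq_norm q (\<beta>hat \<omega> - \<beta>s) powr q
        \<le> 2 powr (3 * q - 2) / \<phi> powr q * \<kappa> powr (2 * q) * real s * \<nu> powr q"
    \<comment> \<open>The level vanishes exactly when \<open>p = 1\<close>. Interpolation needs
      positive bounds, so this case is separate: the l1 bound forces \<open>d = 0\<close> and both
      sides are 0.\<close>
    proof (cases "\<nu> = 0")
      case True
      then have "(\<Sum>j\<in>UNIV. \<bar>d $ j\<bar>) = 0" using bounds(1) by (simp add: sum_nonneg order_antisym)
      then have "d = 0" by (simp add: sum_nonneg_eq_0_iff vec_eq_iff)
      then show ?thesis using True by (simp add: d_def lq_norm_def)
    next
      case False
      have "lq_norm q d powr q \<le> (2 * \<nu> * \<kappa>\<^sup>2 * real s / \<phi>) powr (2 - q)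
          * (16 * \<nu>\<^sup>2 * \<kappa> ^ 4 * real s / \<phi>\<^sup>2) powr (q - 1)"
        using False \<nu> \<kappa> \<phi> \<open>1 \<le> s\<close>
        by (intro lq_norm_powr_interpolation assms bounds) auto
      also have "\<dots> = 2 powr (3 * q - 2) / \<phi> powr q * \<kappa> powr (2 * q) * real s * \<nu> powr q"
        using False \<nu> \<kappa> \<phi> \<open>1 \<le> s\<close> by (intro lq_constant_eq) auto
      finally show ?thesis by (simp add: d_def)
    qed
  qed
  then show ?thesis
    using A unfolding \<kappa>_def \<nu>_def by (intro bexI[of _ A] conjI ballI) blast+
qed

end
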